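(* For every $N\ge 1$, the optimal probability of success in the restricted game of best choice on $\mathrm{Av}_N(231)$ equals $\mathcal{C}_{N-1}/\mathcal{C}_N$, where $\mathcal{C}_n=\frac{1}{n+1}\binom{2n}{n}$ is the $n$th Catalan number. In particular, this optimal probability tends to $1/4$ as $N\to\infty$.
   Context: Permutations of $[N]=\{1,\dots,N\}$ are written in one-line notation $\pi=\pi_1\cdots\pi_N$. A permutation $\pi$ contains a pattern $\rho$ (a permutation of $[M]$) if some subsequence $\pi_{i_1}\cdots\pi_{i_M}$ ($i_1<\dots<i_M$) is in the same relative order as $\rho_1\cdots\rho_M$; otherwise $\pi$ avoids $\rho$. $\mathrm{Av}_N(\rho)$ is the set of $\rho$-avoiding permutations of $[N]$. The flattening of a sequence of $i$ distinct integers is the permutation of $[i]$ with the same relative order; the $i$th prefix flattening $\pi|_{[i]}$ is the flattening of $\pi_1,\dots,\pi_i$. The restricted game of best choice on a set $I_N$ of permutations of $[N]$: a permutation $\pi$ is chosen uniformly at random from $I_N$; for $i=1,2,\dots$ the player is shown $\pi|_{[i]}$ and, using only $\pi|_{[1]},\dots,\pi|_{[i]}$, either accepts candidate $i$ (ending the game) or rejects it forever; if all earlier candidates are rejected, candidate $N$ is accepted. The player wins iff the accepted candidate $i$ has $\pi_i=N$. The optimal probability of success is the maximum winning probability over all strategies. *)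

theory Defs
  imports
    "HOL-Probability.Probability"
    "HOL-Combinatorics.Multiset_Permutations"
    "HOL-Library.Sublist"
begin

section \<open>Patterns\<close>

text \<open>
  A permutation of \<open>{1..N}\<close> in one-line notation is a list in
  \<^term>\<open>permutations_of_set {1..N::nat}\<close>.
\<close>

definition same_relative_order :: "nat list \<Rightarrow> nat list \<Rightarrow> bool" where
  "same_relative_order xs ys \<longleftrightarrow>
     length xs = length ys \<and>
     (\<forall>i < length xs. \<forall>j < length xs. xs ! i < xs ! j \<longleftrightarrow> ys ! i < ys ! j)"

text \<open>\<^const>\<open>subseq\<close> is the library's not necessarily contiguous subsequence relation.\<close>

definition contains_pattern :: "nat list \<Rightarrow> nat list \<Rightarrow> bool" where
  "contains_pattern p r \<longleftrightarrow> (\<exists>ys. subseq ys p \<and> same_relative_order ys r)"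

definition Av :: "nat \<Rightarrow> nat list \<Rightarrow> nat list set" where
  "Av N r = {p \<in> permutations_of_set {1..N}. \<not> contains_pattern p r}"

section \<open>Flattenings\<close>

text \<open>
  Each entry is replaced by its rank. The two lemmas below show that, for distinct entries,
  this is the unique permutation of \<open>{1..length xs}\<close> in the same relative order.
\<close>

definition flatten :: "nat list \<Rightarrow> nat list" where
  "flatten xs = map (\<lambda>x. card {y \<in> set xs. y \<le> x}) xs"

lemma rank_less_iff:
  fixes S :: "nat set"
  assumes "finite S" "x \<in> S" "y \<in> S"
  shows "card {z \<in> S. z \<le> x} < card {z \<in> S. z \<le> y} \<longleftrightarrow> x < y"
proof
  assume "x < y"
  then have "{z \<in> S. z \<le> x} \<subseteq> {z \<in> S. z \<le> y}" "y \<in> {z \<in> S. z \<le> y} - {z \<in> S. z \<le> x}"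
    using assms by auto
  then have "{z \<in> S. z \<le> x} \<subset> {z \<in> S. z \<le> y}" by blast
  with assms show "card {z \<in> S. z \<le> x} < card {z \<in> S. z \<le> y}"
    by (intro psubset_card_mono) auto
next
  assume less: "card {z \<in> S. z \<le> x} < card {z \<in> S. z \<le> y}"
  show "x < y"
  proof (rule ccontr)
    assume "\<not> x < y"
    then have "{z \<in> S. z \<le> y} \<subseteq> {z \<in> S. z \<le> x}" by auto
    then have "card {z \<in> S. z \<le> y} \<le> card {z \<in> S. z \<le> x}"
      using assms by (intro card_mono) auto
    with less show False by simp
  qed
qed

lemma flatten_same_relative_order: "same_relative_order xs (flatten xs)"
  by (auto simp: same_relative_order_def flatten_def rank_less_iff)

lemma flatten_permutation:
  assumes "distinct xs"
  shows "flatten xs \<in> permutations_of_set {1..length xs}"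
proof -
  let ?r = "\<lambda>x. card {y \<in> set xs. y \<le> x}"
  have inj: "inj_on ?r (set xs)"
  proof (rule inj_onI)
    fix x y assume "x \<in> set xs" "y \<in> set xs" "?r x = ?r y"
    then show "x = y"
      using rank_less_iff[of "set xs" x y] rank_less_iff[of "set xs" y x] by force
  qed
  have range: "?r x \<in> {1..length xs}" if "x \<in> set xs" for x
  proof -
    have "?r x \<le> card (set xs)" by (intro card_mono) auto
    moreover have "0 < ?r x" using that by (auto simp: card_gt_0_iff)
    ultimately show ?thesis using card_length[of xs] by simp
  qed
  have "?r ` set xs = {1..length xs}"
  proof (rule card_subset_eq)
    show "?r ` set xs \<subseteq> {1..length xs}" using range by blast
    show "card (?r ` set xs) = card {1..length xs}"
      using inj assms by (simp add: card_image distinct_card)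
  qed simp
  then show ?thesis
    using inj assms by (auto simp: permutations_of_set_def flatten_def distinct_map)
qed

lemma flatten_unique:
  assumes "ys \<in> permutations_of_set {1..length xs}" "same_relative_order xs ys"
  shows "ys = flatten xs"
proof (rule nth_equalityI)
  have ys: "distinct ys" "set ys = {1..length xs}" and len: "length ys = length xs"
    using assms by (auto simp: permutations_of_set_def same_relative_order_def)
  show "length ys = length (flatten xs)" by (simp add: flatten_def len)
  have ord: "xs ! i < xs ! j \<longleftrightarrow> ys ! i < ys ! j" if "i < length xs" "j < length xs" for i j
    using assms(2) that by (auto simp: same_relative_order_def)
  have eq: "i = j" if "xs ! i = xs ! j" "i < length xs" "j < length xs" for i j
    using ord[of i j] ord[of j i] that ys(1) len by (auto simp: nth_eq_iff_index_eq)
  then have dist: "distinct xs" by (auto simp: distinct_conv_nth)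
  fix i assume "i < length ys"
  then have i: "i < length xs" by (simp add: len)
  let ?J = "{j. j < length xs \<and> xs ! j \<le> xs ! i}"
  have J: "?J = {j. j < length xs \<and> ys ! j \<le> ys ! i}"
    using ord i by (auto simp: not_less[symmetric])
  have "{y \<in> set xs. y \<le> xs ! i} = (\<lambda>j. xs ! j) ` ?J"
    by (auto simp: in_set_conv_nth)
  then have "card {y \<in> set xs. y \<le> xs ! i} = card ?J"
    using dist by (simp add: card_image inj_on_def nth_eq_iff_index_eq)
  also have "\<dots> = card ((\<lambda>j. ys ! j) ` ?J)"
    using ys(1) len by (simp add: card_image inj_on_def nth_eq_iff_index_eq)
  also have "(\<lambda>j. ys ! j) ` ?J = {y \<in> set ys. y \<le> ys ! i}"
    unfolding J by (auto simp: in_set_conv_nth len)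
  also have "\<dots> = {1..ys ! i}"
    using nth_mem[of i ys] i len by (auto simp: ys(2))
  finally show "ys ! i = flatten xs ! i"
    using i by (simp add: flatten_def)
qed

definition prefix_flattening :: "nat \<Rightarrow> nat list \<Rightarrow> nat list" where
  "prefix_flattening i p = flatten (take i p)"

section \<open>The restricted game of best choice\<close>

text \<open>
  A strategy decides, from the list of prefix flattenings seen so far, whether the current
  candidate is accepted.
\<close>

type_synonym strategy = "nat list list \<Rightarrow> bool"

definition history :: "nat \<Rightarrow> nat list \<Rightarrow> nat list list" where
  "history i p = map (\<lambda>k. prefix_flattening k p) [1..<Suc i]"

definition accepted :: "nat \<Rightarrow> strategy \<Rightarrow> nat list \<Rightarrow> nat" where
  "accepted N \<sigma> p = (LEAST i. 1 \<le> i \<and> (i = N \<or> \<sigma> (history i p)))"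

text \<open>Candidates are numbered from 1, list positions from 0.\<close>

definition wins :: "nat \<Rightarrow> strategy \<Rightarrow> nat list \<Rightarrow> bool" where
  "wins N \<sigma> p \<longleftrightarrow> p ! (accepted N \<sigma> p - 1) = N"

definition win_prob :: "nat \<Rightarrow> nat list set \<Rightarrow> strategy \<Rightarrow> real" where
  "win_prob N I \<sigma> = measure_pmf.prob (pmf_of_set I) {p. wins N \<sigma> p}"

text \<open>
  There are infinitely many strategies, but only finitely many winning probabilities
  (lemma \<open>finite_win_probs\<close>), so that the maximum is attained.
\<close>

definition optimal_prob :: "nat \<Rightarrow> nat list set \<Rightarrow> real" where
  "optimal_prob N I = Max (range (win_prob N I))"

lemma finite_win_probs:
  assumes "finite I" "I \<noteq> {}"
  shows "finite (range (win_prob N I))"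
proof (rule finite_subset)
  show "range (win_prob N I) \<subseteq> (\<lambda>A. real (card A) / real (card I)) ` Pow I"
    using assms by (auto simp: win_prob_def measure_pmf_of_set)
  show "finite ((\<lambda>A. real (card A) / real (card I)) ` Pow I)"
    using assms by simp
qed

lemma finite_Av: "finite (Av N r)"
  by (simp add: Av_def)

lemma Av_231_nonempty: "Av N [2, 3, 1] \<noteq> {}"
proof -
  have "\<not> contains_pattern [1..<Suc N] [2, 3, 1]"
  proof
    assume "contains_pattern [1..<Suc N] [2, 3, 1]"
    then obtain ys where ys: "subseq ys [1..<Suc N]" "same_relative_order ys [2, 3, 1]"
      by (auto simp: contains_pattern_def)
    have "sorted ys"
      using ys(1) by (metis subseq_conv_nths sorted_nths sorted_upt)
    moreover have "length ys = 3" "ys ! 2 < ys ! 0"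
      using ys(2) by (auto simp: same_relative_order_def)
    ultimately show False
      using sorted_nth_mono[of ys 0 2] by simp
  qed
  then have "[1..<Suc N] \<in> Av N [2, 3, 1]"
    by (auto simp: Av_def permutations_of_set_def)
  then show ?thesis by blast
qed

section \<open>Catalan numbers\<close>

definition catalan :: "nat \<Rightarrow> real" where
  "catalan n = 1 / (real n + 1) * real ((2 * n) choose n)"

end

theory Submission
  imports Defs "HOL-Real_Asymp.Real_Asymp"
begin

text \<open>
  Deleting the entry \<open>N\<close> maps \<open>Av N [2,3,1]\<close> to \<open>Av (N - 1) [2,3,1]\<close>, and for every
  strategy this map is injective on the permutations that the strategy wins. Indeed, if
  \<open>L @ N # R\<close> avoids \<open>231\<close>, then \<open>L\<close> lies below \<open>R\<close>. So if \<open>N\<close> is put back further to the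
  right, then position \<open>length L + 1\<close> still holds a new maximum, the history up to there is
  unchanged, and a strategy that accepts there in the first permutation stops too early in
  the second. Hence no strategy beats accepting the first candidate, which wins exactly on
  the permutations \<open>N # q\<close> with \<open>q\<close> in \<open>Av (N - 1) [2,3,1]\<close>.
\<close>

declare One_nat_def [simp del] \<comment> \<open>otherwise the pattern becomes \<open>[2, 3, Suc 0]\<close>\<close>

section \<open>Avoiding 231\<close>

text \<open>The values are named in increasing order, so an occurrence reads \<open>b, c, a\<close>.
  Later arguments about 231 use this form instead of index comparisons.\<close>

lemma contains_231_iff:
  "contains_pattern p [2, 3, 1] \<longleftrightarrow> (\<exists>a b c. subseq [b, c, a] p \<and> a < b \<and> b < c)"
proof
  assume "contains_pattern p [2, 3, 1]"
  then obtain ys where ys: "subseq ys p" "same_relative_order ys [2, 3, 1]"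
    by (auto simp: contains_pattern_def)
  then obtain b c a where "ys = [b, c, a]"
    by (auto simp: same_relative_order_def length_Suc_conv numeral_3_eq_3)
  moreover from ys(2) have "ys ! 2 < ys ! 0" "ys ! 0 < ys ! 1"
    by (auto simp: same_relative_order_def)
  ultimately show "\<exists>a b c. subseq [b, c, a] p \<and> a < b \<and> b < c"
    using ys(1) by auto
next
  assume "\<exists>a b c. subseq [b, c, a] p \<and> a < b \<and> b < c"
  then obtain a b c where abc: "subseq [b, c, a] p" "a < b" "b < c"
    by blast
  then have "same_relative_order [b, c, a] [2, 3, 1]"
    by (auto simp: same_relative_order_def less_Suc_eq numeral_3_eq_3)
  with abc(1) show "contains_pattern p [2, 3, 1]"
    by (auto simp: contains_pattern_def)
qed

lemma contains_pattern_subseq: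
  assumes "contains_pattern p r" "subseq p q"
  shows "contains_pattern q r"
  using assms unfolding contains_pattern_def by (blast intro: subseq_order.order_trans)

lemma subseq_set_subset: "subseq xs ys \<Longrightarrow> set xs \<subseteq> set ys"
  by (auto simp: subseq_conv_nths dest: in_set_nthsD)

text \<open>An entry of \<open>L\<close> above an entry of \<open>R\<close> would form a 231 with
  \<open>m\<close> as its 3. Conversely, an occurrence that straddles the cut before
  \<open>m\<close> has its 2 in \<open>L\<close> and its 1 in \<open>m # R\<close>, against the
  order. The inequality is weak because entries may repeat here.\<close>

lemma avoids_231_append_Cons_iff:
  assumes "\<And>x. x \<in> set L \<union> set R \<Longrightarrow> x < m"
  shows "\<not> contains_pattern (L @ m # R) [2, 3, 1] \<longleftrightarrow>
    \<not> contains_pattern L [2, 3, 1] \<and> \<not> contains_pattern R [2, 3, 1] \<and>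
    (\<forall>x \<in> set L. \<forall>y \<in> set R. x \<le> y)" (is "?lhs \<longleftrightarrow> ?rhs")
proof
  assume l: ?lhs
  have "x \<le> y" if "x \<in> set L" "y \<in> set R" for x y
  proof (rule ccontr)
    assume "\<not> x \<le> y"
    have "subseq ([x] @ [m] @ [y]) (L @ [m] @ R)"
      using that by (intro list_emb_append_mono) (auto simp: subseq_singleton_left)
    then have "subseq [x, m, y] (L @ m # R)"
      by simp
    moreover have "y < x" "x < m"
      using \<open>\<not> x \<le> y\<close> assms that(1) by auto
    ultimately show False
      using l unfolding contains_231_iff by blast
  qed
  moreover have "subseq L (L @ m # R)"
    by (simp add: subseq_rev_drop_many)
  moreover have "subseq R (L @ m # R)"
    by (intro subseq_drop_many list_emb_Cons subseq_order.order_refl)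
  ultimately show ?rhs
    using l by (metis contains_pattern_subseq)
next
  assume r: ?rhs
  show ?lhs
  proof
    assume "contains_pattern (L @ m # R) [2, 3, 1]"
    then obtain a b c where abc: "subseq [b, c, a] (L @ m # R)" "a < b" "b < c"
      by (auto simp: contains_231_iff)
    then obtain u v where uv: "[b, c, a] = u @ v" "subseq u L" "subseq v (m # R)"
      by (auto simp: subseq_append_iff)
    have setu: "set u \<subseteq> set L" and setv: "set v \<subseteq> insert m (set R)"
      using uv(2,3)[THEN subseq_set_subset] by simp_all
    have "u = [] \<and> v = [b, c, a] \<or> u = [b] \<and> v = [c, a] \<or> u = [b, c] \<and> v = [a]
        \<or> u = [b, c, a]"
      using uv(1) by (auto simp: Cons_eq_append_conv)
    then consider "u = []" "v = [b, c, a]" | "u = [b]" "v = [c, a]" | "u = [b, c]" "v = [a]"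
      | "u = [b, c, a]"
      by blast
    then show False
    proof cases
      case 1
      \<comment> \<open>\<open>m\<close> cannot be the 2, as no entry exceeds it; so the whole
        occurrence lies in \<open>R\<close>.\<close>
      have "b \<noteq> m"
        using assms abc(3) setv 1 by fastforce
      then have "subseq [b, c, a] R"
        using uv(3) 1 by (auto simp: subseq_Cons2_iff split: if_splits)
      then show False
        using r abc(2,3) unfolding contains_231_iff by blast
    next
      case 2
      then have "b \<in> set L" "a \<in> insert m (set R)"
        using setu setv by auto
      then have "b \<le> a"
        using r assms by (auto intro: less_imp_le)
      then show False
        using abc(2) by simp
    next
      case 3
      then have "b \<in> set L" "a \<in> insert m (set R)"
        using setu setv by auto
      then have "b \<le> a"
        using r assms by (auto intro: less_imp_le)
      then show False
        using abc(2) by simp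
    next
      case 4
      then have "contains_pattern L [2, 3, 1]"
        using uv(2) abc(2,3) unfolding contains_231_iff by blast
      with r show False
        by simp
    qed
  qed
qed

lemma Av_D:
  assumes "p \<in> Av n r"
  shows "distinct p" "set p = {1..n}" "length p = n" "\<not> contains_pattern p r"
proof -
  show *: "distinct p" "set p = {1..n}" "\<not> contains_pattern p r"
    using assms by (simp_all add: Av_def permutations_of_set_def)
  show "length p = n"
    using distinct_card[OF *(1)] unfolding *(2) by simp
qed

lemma Av_I:
  assumes "distinct p" "set p = {1..n}" "\<not> contains_pattern p r"
  shows "p \<in> Av n r"
  using assms by (simp add: Av_def permutations_of_set_def)

text \<open>Distinctness makes the inequality strict. Both the counting bijection and the
  injectivity of deleting the maximum start from this form.\<close>

lemma Av_231_split_max: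
  assumes "p \<in> Av (Suc n) [2, 3, 1]"
  obtains L R where "p = L @ Suc n # R" "distinct (L @ R)" "set (L @ R) = {1..n}"
    "\<not> contains_pattern L [2, 3, 1]" "\<not> contains_pattern R [2, 3, 1]"
    "\<forall>x \<in> set L. \<forall>y \<in> set R. x < y"
proof -
  note p = Av_D[OF assms]
  from p(2) have "Suc n \<in> set p"
    by simp
  then obtain L R where LR: "p = L @ Suc n # R"
    by (meson split_list)
  have dist: "distinct (L @ R)" and "Suc n \<notin> set (L @ R)"
    using p(1) by (auto simp: LR)
  with p(2) have set: "set (L @ R) = {1..n}"
    by (auto simp: LR atLeastAtMostSuc_conv insert_eq_iff)
  then have *: "x < Suc n" if "x \<in> set L \<union> set R" for x
    using that by (metis atLeastAtMost_iff less_Suc_eq_le set_append)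
  have av: "\<not> contains_pattern L [2, 3, 1]" "\<not> contains_pattern R [2, 3, 1]"
    "\<forall>x \<in> set L. \<forall>y \<in> set R. x \<le> y"
    using p(4) avoids_231_append_Cons_iff[OF *] by (auto simp: LR)
  moreover have "\<forall>x \<in> set L. \<forall>y \<in> set R. x < y"
    using av(3) dist by (metis disjoint_iff distinct_append le_neq_implies_less)
  ultimately show thesis
    using av(1,2) by (intro that[OF LR dist set]) blast+
qed

section \<open>Counting\<close>

lemma contains_231_map_add:
  "contains_pattern (map ((+) k) p) [2, 3, 1] \<longleftrightarrow> contains_pattern p [2, 3, 1]"
proof -
  \<comment> \<open>Maps strictly increasing on the entries preserve occurrences; this is applied to
    the shift and to its inverse.\<close>
  have *: "contains_pattern (map f p) [2, 3, 1]"
    if p: "contains_pattern p [2, 3, 1]"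
      and mono: "\<And>x y. x \<in> set p \<Longrightarrow> y \<in> set p \<Longrightarrow> x < y \<Longrightarrow> f x < f y"
    for f p
  proof -
    obtain a b c where abc: "subseq [b, c, a] p" "a < b" "b < c"
      using p unfolding contains_231_iff by blast
    have "set [b, c, a] \<subseteq> set p"
      using abc(1) by (rule subseq_set_subset)
    with abc have "subseq [f b, f c, f a] (map f p)" "f a < f b" "f b < f c"
      using subseq_map[OF abc(1), of f] mono by auto
    then show ?thesis
      unfolding contains_231_iff by blast
  qed
  show ?thesis
  proof
    assume "contains_pattern (map ((+) k) p) [2, 3, 1]"
    \<comment> \<open>Truncated subtraction is strictly increasing here, since all entries are at
      least \<open>k\<close>.\<close>
    then have "contains_pattern (map (\<lambda>x. x - k) (map ((+) k) p)) [2, 3, 1]"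
      by (rule *) auto
    then show "contains_pattern p [2, 3, 1]"
      by (simp add: comp_def)
  qed (auto intro: *)
qed

text \<open>Elements of \<open>B\<close> exceed \<open>Max A\<close>, so every number from 1 to
  \<open>Max A\<close> falls into \<open>A\<close>; \<open>B\<close> is the complement.\<close>

lemma initial_segment_eq:
  fixes A B :: "nat set"
  assumes "A \<union> B = {1..n}" "\<forall>x \<in> A. \<forall>y \<in> B. x < y"
  shows "A = {1..card A}" "B = {card A<..n}"
proof -
  have fin: "finite A"
    using assms(1) by (metis finite_Un finite_atLeastAtMost)
  have "\<exists>m. A = {1..m}"
  proof (cases "A = {}")
    case True
    then show ?thesis
      by (intro exI[of _ 0]) auto
  next
    case False
    have "Max A \<in> A"
      using fin False by simp
    have "A = {1..Max A}"
    proof (intro equalityI subsetI)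
      fix x assume "x \<in> A"
      then show "x \<in> {1..Max A}"
        using assms(1) fin by auto
    next
      fix x assume x: "x \<in> {1..Max A}"
      then have "x \<in> A \<union> B"
        using assms(1) \<open>Max A \<in> A\<close> by (metis UnI1 atLeastAtMost_iff order_trans)
      then show "x \<in> A"
        using assms(2) \<open>Max A \<in> A\<close> x by fastforce
    qed
    then show ?thesis ..
  qed
  then obtain m where m: "A = {1..m}" ..
  then show "A = {1..card A}"
    by simp
  have "A \<inter> B = {}"
    using assms(2) by blast
  then have "B = {1..n} - {1..m}"
    using assms(1) m by blast
  then show "B = {card A<..n}"
    using m by auto
qed

text \<open>The Catalan decomposition: \<open>k\<close> entries precede the maximum and have the
  values 1 to \<open>k\<close>; those after it have the values \<open>k + 1\<close> to
  \<open>n\<close> and are stored shifted down by \<open>k\<close>.\<close>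

lemma bij_betw_Av_231_Suc:
  "bij_betw (\<lambda>(k, L, R). L @ Suc n # map ((+) k) R)
     (SIGMA k:{..n}. Av k [2, 3, 1] \<times> Av (n - k) [2, 3, 1]) (Av (Suc n) [2, 3, 1])"
  (is "bij_betw ?f ?A ?B")
  unfolding bij_betw_def
proof (intro conjI subset_antisym)
  show "inj_on ?f ?A"
  proof (rule inj_onI)
    fix u v assume uv: "u \<in> ?A" "v \<in> ?A" "?f u = ?f v"
    obtain k L R k' L' R' where u: "u = (k, L, R)" and v: "v = (k', L', R')"
      by (metis prod_cases3)
    have k: "k \<le> n" "k' \<le> n"
      and L: "L \<in> Av k [2, 3, 1]" "L' \<in> Av k' [2, 3, 1]"
      and R: "R \<in> Av (n - k) [2, 3, 1]" "R' \<in> Av (n - k') [2, 3, 1]"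
      and eq: "L @ Suc n # map ((+) k) R = L' @ Suc n # map ((+) k') R'"
      using uv by (auto simp: u v)
    \<comment> \<open>The maximum occurs once, so it marks the cut; \<open>length L\<close> then
      recovers \<open>k\<close>.\<close>
    have "Suc n \<notin> set L" "Suc n \<notin> set L'" "Suc n \<notin> set (map ((+) k) R)"
      using k Av_D(2)[OF L(1)] Av_D(2)[OF L(2)] Av_D(2)[OF R(1)] by auto
    with eq have "L = L'" and map: "map ((+) k) R = map ((+) k') R'"
      by (auto simp: append_Cons_eq_iff)
    moreover from this have "k = k'"
      using Av_D(3)[OF L(1)] Av_D(3)[OF L(2)] by simp
    moreover from this have "R = R'"
      using map by (auto simp: inj_map_eq_map)
    ultimately show "u = v"
      by (simp add: u v)
  qed
next
  show "?f ` ?A \<subseteq> ?B"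
  proof (rule image_subsetI)
    fix u assume "u \<in> ?A"
    then obtain k L R where u: "u = (k, L, R)" and k: "k \<le> n"
      and L: "L \<in> Av k [2, 3, 1]" and R: "R \<in> Av (n - k) [2, 3, 1]"
      by auto
    let ?R = "map ((+) k) R"
    have setR: "set ?R = {k<..n}"
    proof -
      have "set ?R = (+) k ` {1..n - k}"
        using Av_D(2)[OF R] by simp
      also have "\<dots> = {k + 1..n}"
        using k by (simp add: image_add_atLeastAtMost)
      finally show ?thesis
        by auto
    qed
    have "L @ Suc n # ?R \<in> ?B"
    proof (rule Av_I)
      show "distinct (L @ Suc n # ?R)"
        using Av_D(1,2)[OF L] Av_D(1)[OF R] setR k by (auto simp: distinct_map)
      show "set (L @ Suc n # ?R) = {1..Suc n}"
        using Av_D(2)[OF L] setR k by auto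
      show "\<not> contains_pattern (L @ Suc n # ?R) [2, 3, 1]"
        using Av_D(2,4)[OF L] Av_D(4)[OF R] setR k
        by (subst avoids_231_append_Cons_iff) (auto simp: contains_231_map_add)
    qed
    then show "?f u \<in> ?B"
      by (simp add: u)
  qed
next
  show "?B \<subseteq> ?f ` ?A"
  proof
    fix p assume "p \<in> ?B"
    then obtain L R where LR: "p = L @ Suc n # R" "distinct (L @ R)" "set (L @ R) = {1..n}"
      "\<not> contains_pattern L [2, 3, 1]" "\<not> contains_pattern R [2, 3, 1]"
      "\<forall>x \<in> set L. \<forall>y \<in> set R. x < y"
      by (rule Av_231_split_max)
    define k where "k = length L"
    have card: "card (set L) = k"
      using LR(2) by (simp add: k_def distinct_card)
    have setL: "set L = {1..k}" and setR: "set R = {k<..n}"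
      using initial_segment_eq[of "set L" "set R" n] LR(3,6) card by auto
    have "length (L @ R) = n"
      using LR(2,3) by (metis card_atLeastAtMost diff_Suc_1 distinct_card)
    then have k: "k \<le> n"
      by (simp add: k_def)
    \<comment> \<open>Nothing is truncated, because all entries of \<open>R\<close> exceed
      \<open>k\<close>.\<close>
    define R' where "R' = map (\<lambda>x. x - k) R"
    have R: "R = map ((+) k) R'"
      using setR by (auto simp: R'_def comp_def intro!: map_idI[symmetric])
    have "set R = (+) k ` {1..n - k}"
    proof -
      have "(+) k ` {1..n - k} = {k + 1..n}"
        using k by (simp add: image_add_atLeastAtMost)
      also have "\<dots> = {k<..n}"
        by auto
      finally show ?thesis
        by (simp only: setR)
    qed
    then have "(+) k ` set R' = (+) k ` {1..n - k}"
      by (simp only: R set_map)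
    moreover have "inj ((+) k)"
      by simp
    ultimately have "set R' = {1..n - k}"
      by (metis inj_image_eq_iff)
    moreover have "distinct R'"
      using LR(2) by (simp add: R distinct_map)
    ultimately have "R' \<in> Av (n - k) [2, 3, 1]"
      using LR(5) by (intro Av_I) (auto simp: R contains_231_map_add)
    moreover have "L \<in> Av k [2, 3, 1]"
      using LR(2,4) setL by (intro Av_I) auto
    ultimately have "(k, L, R') \<in> ?A"
      using k by simp
    moreover have "p = ?f (k, L, R')"
      by (simp add: LR(1) R)
    ultimately show "p \<in> ?f ` ?A"
      by blast
  qed
qed

lemma card_Av_231_Suc:
  "card (Av (Suc n) [2, 3, 1]) =
    (\<Sum>k\<le>n. card (Av k [2, 3, 1]) * card (Av (n - k) [2, 3, 1]))"
proof -
  have "card (Av (Suc n) [2, 3, 1]) = card (SIGMA k:{..n}. Av k [2, 3, 1] \<times> Av (n - k) [2, 3, 1])"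
    using bij_betw_same_card[OF bij_betw_Av_231_Suc] by (rule sym)
  also have "\<dots> = (\<Sum>k\<le>n. card (Av k [2, 3, 1] \<times> Av (n - k) [2, 3, 1]))"
    by (rule card_SigmaI) (simp_all add: finite_Av)
  finally show ?thesis
    by (simp only: card_cartesian_product)
qed

section \<open>Catalan recurrences and the number of 231-avoiders\<close>

lemma catalan_pos: "catalan n > 0"
  unfolding catalan_def by (intro mult_pos_pos divide_pos_pos) auto

text \<open>Pascal's rule and symmetry make the central binomial coefficient twice
  \<open>Suc (2 * n) choose Suc n\<close>, which absorption reduces to
  \<open>2 * n choose n\<close>. Besides the convolution, this gives the limit 1/4.\<close>

lemma catalan_Suc: "(real n + 2) * catalan (Suc n) = (4 * real n + 2) * catalan n"
proof -
  have 1: "real (Suc n) * real (Suc (2 * n) choose Suc n) =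
      real (Suc (2 * n)) * real (2 * n choose n)"
    using Suc_times_binomial_eq[of "2 * n" n] by (metis mult.commute of_nat_mult)
  have "Suc (2 * n) choose n = Suc (2 * n) choose Suc n"
    using binomial_symmetric[of n "Suc (2 * n)"] by (simp add: Suc_diff_le)
  then have "real (2 * Suc n choose Suc n) = 2 * real (Suc (2 * n) choose Suc n)"
    by simp
  with 1 show ?thesis
    by (simp add: catalan_def field_simps)
qed

text \<open>
  Weighting by \<open>k + 1\<close> gives a recurrence for the convolution \<open>T\<close>: the weighted sum is half
  of \<open>(n + 2) T n\<close> by symmetry, and for \<open>n + 1\<close> it reduces to \<open>T n\<close> by \<open>catalan_Suc\<close>.
\<close>
lemma catalan_convolution: "(\<Sum>k\<le>n. catalan k * catalan (n - k)) = catalan (Suc n)"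
proof -
  define T where "T n = (\<Sum>k\<le>n. catalan k * catalan (n - k))" for n
  define S where "S n = (\<Sum>k\<le>n. (real k + 1) * catalan k * catalan (n - k))" for n
  have S_sym: "2 * S n = (real n + 2) * T n" for n
  proof -
    have "S n = (\<Sum>k\<le>n. (real (n - k) + 1) * catalan (n - k) * catalan (n - (n - k)))"
      unfolding S_def atLeast0AtMost[symmetric] by (subst sum.atLeastAtMost_rev) simp
    also have "\<dots> = (\<Sum>k\<le>n. (real n - real k + 1) * (catalan k * catalan (n - k)))"
      by (intro sum.cong) (auto simp: of_nat_diff)
    finally have "2 * S n = (\<Sum>k\<le>n. (real n - real k + 1) * (catalan k * catalan (n - k))
        + (real k + 1) * catalan k * catalan (n - k))"
      by (simp add: S_def sum.distrib)
    also have "\<dots> = (\<Sum>k\<le>n. (real n + 2) * (catalan k * catalan (n - k)))"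
      by (intro sum.cong) (auto simp: algebra_simps)
    finally show ?thesis
      by (simp add: T_def sum_distrib_left)
  qed
  have S_Suc: "S (Suc n) = catalan (Suc n) + (2 * real n + 2) * T n" for n
  proof -
    \<comment> \<open>The term \<open>k = 0\<close> is split off; shifting the index turns the
      weight \<open>k + 1\<close> into the \<open>k + 2\<close> of
      \<open>catalan_Suc\<close>.\<close>
    have "S (Suc n) = catalan (Suc n)
        + (\<Sum>k\<le>n. ((real k + 2) * catalan (Suc k)) * catalan (n - k))"
      unfolding S_def by (subst sum.atMost_Suc_shift) (simp add: catalan_def add_ac)
    also have "(\<Sum>k\<le>n. ((real k + 2) * catalan (Suc k)) * catalan (n - k))
        = (\<Sum>k\<le>n. 4 * ((real k + 1) * catalan k * catalan (n - k))
            - 2 * (catalan k * catalan (n - k)))"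
      unfolding catalan_Suc by (intro sum.cong) (auto simp: algebra_simps)
    also have "\<dots> = 4 * S n - 2 * T n"
      by (simp add: S_def T_def sum_subtractf sum_distrib_left)
    finally show ?thesis
      using S_sym[of n] by (simp add: algebra_simps)
  qed
  have "T n = catalan (Suc n)" for n
  proof (induction n)
    case 0
    then show ?case
      by (simp add: T_def catalan_def)
  next
    case (Suc n)
    have "(real n + 3) * T (Suc n) = 2 * S (Suc n)"
      using S_sym[of "Suc n"] by simp
    also have "\<dots> = (4 * real n + 6) * catalan (Suc n)"
      by (simp add: S_Suc Suc algebra_simps)
    also have "\<dots> = (real n + 3) * catalan (Suc (Suc n))"
      using catalan_Suc[of "Suc n"] by (simp add: algebra_simps)
    finally show ?case
      by simp
  qed
  then show ?thesis
    by (simp add: T_def)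
qed

text \<open>Both sides satisfy the same convolution recurrence; it reaches back to all smaller
  lengths, hence the strong induction.\<close>

lemma card_Av_231: "real (card (Av n [2, 3, 1])) = catalan n"
proof (induction n rule: less_induct)
  case (less n)
  show ?case
  proof (cases n)
    case 0
    have "Av 0 [2, 3, 1] = {[]}"
      by (auto simp: Av_def permutations_of_set_def contains_231_iff)
    then show ?thesis
      by (simp add: 0 catalan_def)
  next
    case (Suc m)
    then show ?thesis
      by (simp add: card_Av_231_Suc less.IH flip: catalan_convolution)
  qed
qed

section \<open>Strategies\<close>

text \<open>A new maximum leaves the earlier ranks alone, and its own rank does not depend on its
  value.\<close>

lemma flatten_append_max:
  assumes "distinct L" "\<And>x. x \<in> set L \<Longrightarrow> x < m"
  shows "flatten (L @ [m]) = flatten L @ [Suc (length L)]"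
proof -
  have "{y \<in> insert m (set L). y \<le> x} = {y \<in> set L. y \<le> x}" if "x \<in> set L" for x
    using assms(2)[OF that] by auto
  moreover have "{y \<in> insert m (set L). y \<le> m} = insert m (set L)"
    using assms(2) by (auto intro: less_imp_le)
  moreover have "m \<notin> set L"
    using assms(2) by blast
  ultimately show ?thesis
    using assms(1) by (simp add: flatten_def distinct_card)
qed

text \<open>The player sees only ranks, so two new maxima after \<open>L\<close> look alike, and
  later entries are still hidden. It will be used with the true maximum as \<open>m\<close> and a
  smaller entry as \<open>m'\<close>.\<close>

lemma history_append_max:
  assumes "distinct L" "\<And>x. x \<in> set L \<Longrightarrow> x < m" "\<And>x. x \<in> set L \<Longrightarrow> x < m'"
  shows "history (Suc (length L)) (L @ m # R) = history (Suc (length L)) (L @ m' # R')"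
  unfolding history_def
proof (rule map_cong[OF refl])
  fix k assume "k \<in> set [1..<Suc (Suc (length L))]"
  then consider "k \<le> length L" | "k = Suc (length L)"
    by fastforce
  then show "prefix_flattening k (L @ m # R) = prefix_flattening k (L @ m' # R')"
  proof cases
    case 1
    then show ?thesis
      by (simp add: prefix_flattening_def)
  next
    case 2
    then show ?thesis
      using flatten_append_max[OF assms(1,2)] flatten_append_max[OF assms(1,3)]
      by (simp add: prefix_flattening_def)
  qed
qed

text \<open>The forced acceptance of candidate \<open>N\<close> is a witness for the
  \<open>LEAST\<close>, so the minimum exists.\<close>

lemma accepted_props:
  assumes "N \<ge> 1"
  shows "1 \<le> accepted N \<sigma> p" "accepted N \<sigma> p \<le> N"
    "accepted N \<sigma> p = N \<or> \<sigma> (history (accepted N \<sigma> p) p)"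
    "\<And>i. 1 \<le> i \<Longrightarrow> \<sigma> (history i p) \<Longrightarrow> accepted N \<sigma> p \<le> i"
proof -
  let ?P = "\<lambda>i. 1 \<le> i \<and> (i = N \<or> \<sigma> (history i p))"
  have "?P N"
    using assms by simp
  then have "?P (accepted N \<sigma> p)"
    unfolding accepted_def by (rule LeastI)
  then show "1 \<le> accepted N \<sigma> p" "accepted N \<sigma> p = N \<or> \<sigma> (history (accepted N \<sigma> p) p)"
    by auto
  show "accepted N \<sigma> p \<le> N"
    unfolding accepted_def using \<open>?P N\<close> by (rule Least_le)
  show "accepted N \<sigma> p \<le> i" if "1 \<le> i" "\<sigma> (history i p)" for i
    unfolding accepted_def using that by (intro Least_le) simp
qed

text \<open>\<open>N\<close> occurs only once, so winning determines the position;
  \<open>Suc\<close> converts it to a candidate number.\<close>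

lemma wins_imp_accepted:
  assumes "wins N \<sigma> (L @ N # R)" "distinct (L @ N # R)" "length (L @ N # R) = N"
  shows "accepted N \<sigma> (L @ N # R) = Suc (length L)"
proof -
  let ?p = "L @ N # R"
  have acc: "1 \<le> accepted N \<sigma> ?p" "accepted N \<sigma> ?p \<le> N"
    using accepted_props(1,2)[of N \<sigma> ?p] assms(3) by auto
  have "?p ! (accepted N \<sigma> ?p - 1) = ?p ! length L"
    using assms(1) by (simp add: wins_def)
  moreover have "accepted N \<sigma> ?p - 1 < length ?p"
    using acc unfolding assms(3) by linarith
  ultimately have "accepted N \<sigma> ?p - 1 = length L"
    using assms(2) nth_eq_iff_index_eq[of ?p "accepted N \<sigma> ?p - 1" "length L"] by simp
  with acc show ?thesis
    by simp
qed

section \<open>Upper and lower bounds on the number of wins\<close>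

lemma inj_on_delete_max:
  "inj_on (remove1 (Suc n)) {p \<in> Av (Suc n) [2, 3, 1]. wins (Suc n) \<sigma> p}"
proof -
  let ?m = "Suc n"
  have no_later: False
    if p: "L @ ?m # R \<in> Av ?m [2, 3, 1]" "wins ?m \<sigma> (L @ ?m # R)"
      and p': "L' @ ?m # R' \<in> Av ?m [2, 3, 1]" "wins ?m \<sigma> (L' @ ?m # R')"
      and eq: "L @ R = L' @ R'" and less: "length L < length L'"
    for L R L' R'
  proof -
    \<comment> \<open>\<open>x\<close> is the entry of the second permutation at the place where the
      first has its maximum.\<close>
    obtain x M where L': "L' = L @ x # M" and R: "R = x # M @ R'"
    proof -
      from eq less obtain us where "L' = L @ us" "us @ R' = R"
        by (auto simp: append_eq_append_conv2)
      with less that show thesis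
        by (cases us) auto
    qed
    from p(1) obtain L1 R1 where LR: "L @ ?m # R = L1 @ ?m # R1" "distinct (L1 @ R1)"
      "set (L1 @ R1) = {1..n}" "\<not> contains_pattern L1 [2, 3, 1]"
      "\<not> contains_pattern R1 [2, 3, 1]" "\<forall>x \<in> set L1. \<forall>y \<in> set R1. x < y"
      by (rule Av_231_split_max)
    have "?m \<notin> set (L1 @ R1)"
      unfolding LR(3) by simp
    with LR(1) have "L1 = L" "R1 = R"
      using append_Cons_eq_iff[of ?m L1 R1 L R] by auto
    \<comment> \<open>Since \<open>x\<close> starts \<open>R\<close>, which lies above
      \<open>L\<close>, it is a new maximum after \<open>L\<close>.\<close>
    have x: "y < x" "y < ?m" if "y \<in> set L" for y
    proof -
      show "y < x"
        using LR(6) that \<open>L1 = L\<close> \<open>R1 = R\<close> R by auto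
      have "y \<in> {1..n}"
        using that \<open>L1 = L\<close> unfolding LR(3)[symmetric] by simp
      then show "y < ?m"
        by simp
    qed
    have acc: "accepted ?m \<sigma> (L @ ?m # R) = Suc (length L)"
      using wins_imp_accepted[OF p(2) Av_D(1)[OF p(1)] Av_D(3)[OF p(1)]] .
    have acc': "accepted ?m \<sigma> (L' @ ?m # R') = Suc (length L')"
      using wins_imp_accepted[OF p'(2) Av_D(1)[OF p'(1)] Av_D(3)[OF p'(1)]] .
    \<comment> \<open>This excludes the forced acceptance of the last candidate: the strategy itself
      chose to stop here.\<close>
    have "Suc (length L) < ?m"
      using less Av_D(3)[OF p'(1)] by simp
    with acc have "\<sigma> (history (Suc (length L)) (L @ ?m # R))"
      using accepted_props(3)[of ?m \<sigma> "L @ ?m # R"] by auto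
    also have "history (Suc (length L)) (L @ ?m # R)
        = history (Suc (length L)) (L @ x # M @ ?m # R')"
      using Av_D(1)[OF p(1)] x by (intro history_append_max) auto
    also have "L @ x # M @ ?m # R' = L' @ ?m # R'"
      by (simp add: L')
    finally have "accepted ?m \<sigma> (L' @ ?m # R') \<le> Suc (length L)"
      using accepted_props(4)[of ?m "Suc (length L)"] by simp
    with acc' less show False
      by simp
  qed
  show ?thesis
  proof (rule inj_onI, clarify)
    fix p p'
    assume p: "p \<in> Av ?m [2, 3, 1]" "wins ?m \<sigma> p"
      and p': "p' \<in> Av ?m [2, 3, 1]" "wins ?m \<sigma> p'"
      and eq: "remove1 ?m p = remove1 ?m p'"
    obtain L R where LR: "p = L @ ?m # R" "?m \<notin> set L"
      using p(1) split_list_first[of ?m p] Av_D(2)[OF p(1)] by auto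
    obtain L' R' where LR': "p' = L' @ ?m # R'" "?m \<notin> set L'"
      using p'(1) split_list_first[of ?m p'] Av_D(2)[OF p'(1)] by auto
    have app: "L @ R = L' @ R'"
      using eq LR LR' by (simp add: remove1_append)
    \<comment> \<open>By symmetry \<open>no_later\<close> excludes either maximum coming
      earlier.\<close>
    then have "length L = length L'"
      using no_later[of L R L' R'] no_later[of L' R' L R] p p' LR(1) LR'(1)
      by (metis linorder_neqE_nat)
    with app show "p = p'"
      by (simp add: LR LR')
  qed
qed

text \<open>The injection lands in \<open>Av n [2, 3, 1]\<close> because deleting an entry leaves a
  subsequence, which still avoids 231.\<close>

lemma card_wins_le:
  "card {p \<in> Av (Suc n) [2, 3, 1]. wins (Suc n) \<sigma> p} \<le> card (Av n [2, 3, 1])"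
proof (rule card_inj_on_le)
  show "inj_on (remove1 (Suc n)) {p \<in> Av (Suc n) [2, 3, 1]. wins (Suc n) \<sigma> p}"
    by (rule inj_on_delete_max)
  show "finite (Av n [2, 3, 1])"
    by (rule finite_Av)
  show "remove1 (Suc n) ` {p \<in> Av (Suc n) [2, 3, 1]. wins (Suc n) \<sigma> p} \<subseteq> Av n [2, 3, 1]"
  proof (rule image_subsetI)
    fix p assume "p \<in> {p \<in> Av (Suc n) [2, 3, 1]. wins (Suc n) \<sigma> p}"
    then have p: "p \<in> Av (Suc n) [2, 3, 1]"
      by simp
    have "set (remove1 (Suc n) p) = {1..Suc n} - {Suc n}"
      using Av_D(1,2)[OF p] by simp
    also have "\<dots> = {1..n}"
      by (simp add: atLeastAtMostSuc_conv)
    finally have "set (remove1 (Suc n) p) = {1..n}" .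
    moreover have "\<not> contains_pattern (remove1 (Suc n) p) [2, 3, 1]"
    proof
      assume "contains_pattern (remove1 (Suc n) p) [2, 3, 1]"
      moreover have "remove1 (Suc n) p = filter ((\<noteq>) (Suc n)) p"
        using Av_D(1)[OF p] by (simp add: distinct_remove1_removeAll removeAll_filter_not_eq)
      ultimately have "contains_pattern p [2, 3, 1]"
        by (metis contains_pattern_subseq subseq_filter_left)
      then show False
        using Av_D(4)[OF p] by blast
    qed
    ultimately show "remove1 (Suc n) p \<in> Av n [2, 3, 1]"
      using Av_D(1)[OF p] by (intro Av_I) auto
  qed
qed

text \<open>Prepending the maximum to a 231-avoider creates no 231, since the 2 is never the largest
  entry; stopping at once then wins.\<close>

lemma card_wins_accept_first:
  "card (Av n [2, 3, 1]) \<le> card {p \<in> Av (Suc n) [2, 3, 1]. wins (Suc n) (\<lambda>_. True) p}"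
proof (rule card_inj_on_le)
  show "inj_on ((#) (Suc n)) (Av n [2, 3, 1])"
    by (auto simp: inj_on_def)
  show "finite {p \<in> Av (Suc n) [2, 3, 1]. wins (Suc n) (\<lambda>_. True) p}"
    using finite_Av by (rule finite_subset[rotated]) auto
  show "(#) (Suc n) ` Av n [2, 3, 1] \<subseteq>
      {p \<in> Av (Suc n) [2, 3, 1]. wins (Suc n) (\<lambda>_. True) p}"
  proof clarify
    fix q assume q: "q \<in> Av n [2, 3, 1]"
    have "\<not> contains_pattern [] [2, 3, 1]"
      by (simp add: contains_231_iff)
    then have "\<not> contains_pattern ([] @ Suc n # q) [2, 3, 1]"
      using Av_D(2,4)[OF q] by (subst avoids_231_append_Cons_iff) auto
    then have "Suc n # q \<in> Av (Suc n) [2, 3, 1]"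
      using Av_D(1,2)[OF q] by (intro Av_I) auto
    moreover have "accepted (Suc n) (\<lambda>_. True) (Suc n # q) = 1"
      by (intro order.antisym accepted_props(1,4)) auto
    ultimately show "Suc n # q \<in> Av (Suc n) [2, 3, 1] \<and> wins (Suc n) (\<lambda>_. True) (Suc n # q)"
      by (simp add: wins_def)
  qed
qed

section \<open>The optimal probability and its limit\<close>

lemma win_prob_eq:
  "win_prob N (Av N [2, 3, 1]) \<sigma> =
    real (card {p \<in> Av N [2, 3, 1]. wins N \<sigma> p}) / real (card (Av N [2, 3, 1]))"
  unfolding win_prob_def
  by (subst measure_pmf_of_set[OF Av_231_nonempty finite_Av]) (simp add: Int_def)

lemma optimal_prob_Av_231_Suc:
  "optimal_prob (Suc n) (Av (Suc n) [2, 3, 1]) = catalan n / catalan (Suc n)"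
  unfolding optimal_prob_def
proof (rule Max_eqI)
  show "finite (range (win_prob (Suc n) (Av (Suc n) [2, 3, 1])))"
    by (rule finite_win_probs[OF finite_Av Av_231_nonempty])
  show "x \<le> catalan n / catalan (Suc n)"
    if "x \<in> range (win_prob (Suc n) (Av (Suc n) [2, 3, 1]))" for x
  proof -
    from that obtain \<sigma> where "x = win_prob (Suc n) (Av (Suc n) [2, 3, 1]) \<sigma>"
      by blast
    then show ?thesis
      unfolding win_prob_eq card_Av_231[symmetric]
      using card_wins_le[of n \<sigma>] by (simp add: divide_right_mono)
  qed
  \<comment> \<open>Accepting the first candidate attains the bound: the two cardinality estimates
    coincide for it.\<close>
  show "catalan n / catalan (Suc n) \<in> range (win_prob (Suc n) (Av (Suc n) [2, 3, 1]))"
  proof (rule range_eqI)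
    show "catalan n / catalan (Suc n) = win_prob (Suc n) (Av (Suc n) [2, 3, 1]) (\<lambda>_. True)"
      using card_wins_le[of n "\<lambda>_. True"] card_wins_accept_first[of n]
      by (simp add: win_prob_eq flip: card_Av_231)
  qed
qed

theorem theorem3p6:
  shows "(\<forall>N \<ge> 1. optimal_prob N (Av N [2, 3, 1]) = catalan (N - 1) / catalan N) \<and>
         (\<lambda>N. optimal_prob N (Av N [2, 3, 1])) \<longlonglongrightarrow> 1 / 4"
proof
  show "\<forall>N \<ge> 1. optimal_prob N (Av N [2, 3, 1]) = catalan (N - 1) / catalan N"
  proof (intro allI impI)
    fix N :: nat assume "1 \<le> N"
    then obtain n where "N = Suc n"
      by (cases N) auto
    then show "optimal_prob N (Av N [2, 3, 1]) = catalan (N - 1) / catalan N"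
      by (simp add: optimal_prob_Av_231_Suc)
  qed
  have "catalan n / catalan (Suc n) = (real n + 2) / (4 * real n + 2)" for n
    using catalan_Suc[of n] catalan_pos[of "Suc n"] by (simp add: frac_eq_eq mult.commute)
  moreover have "(\<lambda>n. (real n + 2) / (4 * real n + 2)) \<longlonglongrightarrow> 1 / 4"
    by real_asymp
  ultimately have "(\<lambda>n. optimal_prob (Suc n) (Av (Suc n) [2, 3, 1])) \<longlonglongrightarrow> 1 / 4"
    by (simp only: optimal_prob_Av_231_Suc)
  then show "(\<lambda>N. optimal_prob N (Av N [2, 3, 1])) \<longlonglongrightarrow> 1 / 4"
    \<comment> \<open>The formula covers only positive lengths, so the limit is taken along
      \<open>Suc n\<close> and shifted back.\<close>
    by (rule LIMSEQ_imp_Suc)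
qed

end
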